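(* Let $X$ be a (finite-dimensional) Euclidean space. For $r=1,2$ let $F_{P_r}:X\to X$ be a differentiable map and let $\mathcal F_r$ be a subset of the set of fixed points of $F_{P_r}$. Put $\alpha(1)=2$, $\alpha(2)=1$. Let $Im\in X$. Suppose that for $r=1,2$ the following conditions hold: (a) For any $a\in\mathcal F_r$ all eigenvalues of the Jacobian of $F_{P_r}$ at $a$ are strictly less than $1$ in absolute value. (b) The sets $\mathcal F_1$ and $\mathcal F_2$ are finite and disjoint. (c) $Im$ belongs to the basin $\mathcal B(a)$ (with respect to $F_{P_1}$) of some $a\in\mathcal F_1$. (d) Every $a\in\mathcal F_r$ belongs to the basin $\mathcal B(a')$ (with respect to $F_{P_{\alpha(r)}}$) of some $a'\in\mathcal F_{\alpha(r)}$ together with an open ball of a certain radius $\delta(a)>0$ around $a$: $B_{\delta(a)}(a)\subset\mathcal B(a')$. Then the sequence $$U(Im,nsteps_1,nsteps_2)=Im\xrightarrow{[F_{P_1}]^{nsteps_1}}T_1\xrightarrow{[F_{P_2}]^{nsteps_2}}T_2\xrightarrow{[F_{P_1}]^{nsteps_1}}T_3\xrightarrow{[F_{P_2}]^{nsteps_2}}T_4\xrightarrow{[F_{P_1}]^{nsteps_1}}\cdots$$ is a bipartite convergent sequence of the second type, converging to an orbit $(b_0,\dots,b_{K-1})$ ($K>0$ even) consisting of alternating attractors of $F_{P_1}$ and $F_{P_2}$ ($b_h$ is an attractor of $F_{P_1}$ for even $h$ and of $F_{P_2}$ for odd $h$). The orbit elements form a loop with respect to alternating $\widehat{F_1},\widehat{F_2}$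 operations: $$b_0\xrightarrow{\widehat{F_2}}b_1\xrightarrow{\widehat{F_1}}\cdots\xrightarrow{\widehat{F_2}}b_{K-1}\xrightarrow{\widehat{F_1}}b_0.$$ Moreover, the orbit elements are alternating fixed points of $\widehat{G_1}=[\widehat{F_1}\circ\widehat{F_2}]^{K/2}$ and $\widehat{G_2}=[\widehat{F_2}\circ\widehat{F_1}]^{K/2}$: $\widehat{G_1}(b_h)=b_h$ for even $h$ and $\widehat{G_2}(b_h)=b_h$ for odd $h$, $0\le h\le K-1$.
   Context: For $f:X\to X$, both $[f]^n$ and $f^{[n]}$ denote the $n$-fold composition of $f$ with itself. $B_\epsilon(x)$ is the open ball of radius $\epsilon$ around $x$ in the Euclidean distance $d$. $f\circ g$ means: apply $g$ first. Eigenvalues of the Jacobian are real or complex. A fixed point $a$ of $f:X\to X$ is an attractor of $f$ if there is an open neighborhood $O$ of $a$ such that $f^{[n]}(y)\to a$ as $n\to\infty$ for all $y\in O$. The basin $\mathcal B(a)$ of $a$ with respect to $f$ is the set of all $y\in X$ with $f^{[n]}(y)\to a$. For $r=1,2$, $\widehat{F_r}(x)=\lim_{n\to\infty}[F_{P_r}]^n(x)$, defined at those $x\in X$ for which the limit exists. The assertions involving $\widehat{F_r}$ at orbit elements include that the relevant limits exist. For positive integers $nsteps_1,nsteps_2$, the elements $T_i=T_i(nsteps_1,nsteps_2)$, $i\ge1$, are defined by $T_1=[F_{P_1}]^{nsteps_1}(Im)$, $T_{i+1}=[F_{P_2}]^{nsteps_2}(T_i)$ for odd $i$, and $T_{i+1}=[F_{P_1}]^{nsteps_1}(T_i)$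 for even $i$. Bipartite convergence of the second type: $U(Im,nsteps_1,nsteps_2)$ is a bipartite convergent sequence of the second type converging to the orbit $(b_j\mid j=0,\dots,K-1)$, $K>0$, if all the $b_j\in X$ are different and for every $j=0,\dots,K-1$ the elements $T_{1+mK+j}(nsteps_1,nsteps_2)$ converge to $b_j$ as $m$, $nsteps_1$ and $nsteps_2$ tend (jointly) to infinity; that is, for every $\epsilon>0$ there is $N$ such that $d(T_{1+mK+j}(nsteps_1,nsteps_2),b_j)<\epsilon$ for all $m,nsteps_1,nsteps_2\ge N$. *)

theory Defs
  imports "HOL-Analysis.Analysis"
begin

definition basin :: "('a::topological_space \<Rightarrow> 'a) \<Rightarrow> 'a \<Rightarrow> 'a set" where
  "basin f a = {y. (\<lambda>n. (f ^^ n) y) \<longlonglongrightarrow> a}"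

definition attractor :: "('a::topological_space \<Rightarrow> 'a) \<Rightarrow> 'a \<Rightarrow> bool" where
  "attractor f a \<longleftrightarrow>
     f a = a \<and> (\<exists>W. open W \<and> a \<in> W \<and> (\<forall>y\<in>W. (\<lambda>n. (f ^^ n) y) \<longlonglongrightarrow> a))"

text \<open>
  Real or complex eigenvalues of the Jacobian matrix of \<open>f\<close> at \<open>a\<close>. Rows and columns are indexed by
  the orthonormal basis \<open>Basis\<close>: the entry in row \<open>i\<close> and column \<open>j\<close> is the partial derivative in
  direction \<open>j\<close> of the \<open>i\<close>-th component of \<open>f\<close>. A complex column vector is a function on \<open>Basis\<close>;
  its values outside \<open>Basis\<close> are irrelevant.
\<close>
definition jacobian_eigenvalue :: "('a::euclidean_space \<Rightarrow> 'a) \<Rightarrow> 'a \<Rightarrow> complex \<Rightarrow> bool" where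
  "jacobian_eigenvalue f a c \<longleftrightarrow>
     (\<exists>v :: 'a \<Rightarrow> complex.
        (\<exists>i\<in>Basis. v i \<noteq> 0) \<and>
        (\<forall>i\<in>Basis. (\<Sum>j\<in>Basis. complex_of_real (frechet_derivative f (at a) j \<bullet> i) * v j) = c * v i))"

text \<open>
  The limit of the iterates as a partial function: a value \<open>Some y\<close> includes the claim that the
  limit exists. Compositions and powers of such maps are therefore taken as partial functions.
\<close>
definition limit_map :: "('a::t2_space \<Rightarrow> 'a) \<Rightarrow> 'a \<rightharpoonup> 'a" where
  "limit_map f x =
     (if convergent (\<lambda>n. (f ^^ n) x) then Some (lim (\<lambda>n. (f ^^ n) x)) else None)"

primrec map_power :: "('a \<rightharpoonup> 'a) \<Rightarrow> nat \<Rightarrow> 'a \<rightharpoonup> 'a" where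
  "map_power g 0 = Some"
| "map_power g (Suc n) = g \<circ>\<^sub>m map_power g n"

text \<open>
  The elements \<open>T\<^sub>i\<close>, \<open>i \<ge> 1\<close>, are the values at positive indices; index \<open>0\<close> is the starting point.
\<close>
primrec alt_seq ::
  "('a \<Rightarrow> 'a) \<Rightarrow> ('a \<Rightarrow> 'a) \<Rightarrow> 'a \<Rightarrow> nat \<Rightarrow> nat \<Rightarrow> nat \<Rightarrow> 'a" where
  "alt_seq f g x n1 n2 0 = x"
| "alt_seq f g x n1 n2 (Suc i) =
     (if even i then (f ^^ n1) (alt_seq f g x n1 n2 i) else (g ^^ n2) (alt_seq f g x n1 n2 i))"

text \<open>
  The arguments of \<open>T\<close> are the two (positive) step numbers and the index; the orbit consists of the
  values of \<open>b\<close> at \<open>0, \<dots>, K - 1\<close>. The bound \<open>N \<ge> 1\<close> only keeps the step numbers positive.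
\<close>
definition bipartite_convergent_second ::
  "(nat \<Rightarrow> nat \<Rightarrow> nat \<Rightarrow> 'a::metric_space) \<Rightarrow> nat \<Rightarrow> (nat \<Rightarrow> 'a) \<Rightarrow> bool" where
  "bipartite_convergent_second T K b \<longleftrightarrow>
     K > 0 \<and> inj_on b {..<K} \<and>
     (\<forall>j<K. \<forall>\<epsilon>>0. \<exists>N\<ge>1. \<forall>m\<ge>N. \<forall>n1\<ge>N. \<forall>n2\<ge>N. dist (T n1 n2 (1 + m * K + j)) (b j) < \<epsilon>)"

end

theory Submission
  imports Defs "Jordan_Normal_Form.Spectral_Radius"
begin

text \<open>
  If all eigenvalues of the Jacobian \<open>L\<close> of \<open>f\<close> at a fixed point \<open>a\<close> lie in the open unit disc, then
  \<open>\<parallel>L\<^sup>k\<parallel> \<le> C q\<^sup>k\<close> with \<open>q < 1\<close>, so some iterate of \<open>f\<close> contracts a ball around \<open>a\<close> and the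
  iterates of \<open>f\<close> converge to \<open>a\<close> uniformly on that ball. By continuity of a single iterate, every
  point of the basin of \<open>a\<close> has a neighbourhood with the same property. Passing from each point of the
  two finite sets to the limit of its iterates under the other map is a self-map of a finite set,
  whose orbits are eventually periodic. If all these neighbourhoods contain the balls of radius \<open>e\<close>,
  then for all large step numbers the sequence \<open>T\<close> shadows such an orbit within \<open>e\<close>, at all times
  simultaneously.
\<close>

no_notation scalar_prod (infix "\<bullet>" 70)

section \<open>Geometric decay of powers of matrices and linear maps\<close>

lemma smult_pow_mat:
  fixes A :: "'a::comm_ring_1 mat"
  assumes A: "A \<in> carrier_mat n n"
  shows "(c \<cdot>\<^sub>m A) ^\<^sub>m k = c ^ k \<cdot>\<^sub>m (A ^\<^sub>m k)"
proof (induction k)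
  case 0
  show ?case using A by (intro eq_matI) auto
next
  case (Suc k)
  have Ak: "A ^\<^sub>m k \<in> carrier_mat n n" using A by simp
  have "(c \<cdot>\<^sub>m A) ^\<^sub>m Suc k = (c ^ k \<cdot>\<^sub>m (A ^\<^sub>m k)) * (c \<cdot>\<^sub>m A)"
    using Suc by simp
  also have "\<dots> = c ^ k \<cdot>\<^sub>m (c \<cdot>\<^sub>m (A ^\<^sub>m k * A))"
    using mult_smult_assoc_mat[OF Ak, of "c \<cdot>\<^sub>m A" n] mult_smult_distrib[OF Ak A] A by simp
  also have "\<dots> = c ^ Suc k \<cdot>\<^sub>m (A ^\<^sub>m Suc k)"
    using A by (intro eq_matI) (auto simp: mult_ac)
  finally show ?case .
qed

text \<open>Dividing \<open>A\<close> by some \<open>q\<close> strictly between its spectral radius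
  and 1 leaves a matrix of spectral radius below 1. The Jordan form bounds the entries of all powers
  of that matrix by one constant, and scaling back contributes \<open>q ^ k\<close>.\<close>

lemma pow_mat_geometric_bound:
  fixes A :: "complex mat"
  assumes A: "A \<in> carrier_mat n n" and n: "n > 0"
    and ev: "\<And>k. eigenvalue A k \<Longrightarrow> norm k < 1"
  shows "\<exists>c q. 0 < q \<and> q < 1 \<and> (\<forall>k. norm_bound (A ^\<^sub>m k) (c * q ^ k))"
proof -
  have mem: "spectral_radius A \<in> norm ` spectrum A"
    using spectral_radius_mem_max(1)[OF A n] .
  then have sr: "0 \<le> spectral_radius A" "spectral_radius A < 1"
    using ev by (auto simp: spectrum_def)
  \<comment> \<open>The midpoint is positive even when the spectral radius is 0, so dividing by it
    is legitimate.\<close>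
  define q where "q = (spectral_radius A + 1) / 2"
  have q: "0 < q" "q < 1" "spectral_radius A < q"
    using sr by (auto simp: q_def)
  define B where "B = complex_of_real (1 / q) \<cdot>\<^sub>m A"
  have B: "B \<in> carrier_mat n n" using A by (simp add: B_def)
  have AB: "A = complex_of_real q \<cdot>\<^sub>m B"
    using q by (intro eq_matI) (auto simp: B_def)
  have "norm k < 1" if k: "eigenvalue B k" for k
  proof -
    obtain v where v: "v \<in> carrier_vec n" "v \<noteq> 0\<^sub>v n" "B *\<^sub>v v = k \<cdot>\<^sub>v v"
      using k B by (auto simp: eigenvalue_def eigenvector_def)
    have "A *\<^sub>v v = complex_of_real q \<cdot>\<^sub>v (B *\<^sub>v v)"
      using B v(1) unfolding AB by (intro eq_vecI) auto
    also have "\<dots> = (complex_of_real q * k) \<cdot>\<^sub>v v"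
      using v by (simp add: smult_smult_assoc)
    finally have "eigenvalue A (complex_of_real q * k)"
      using v A by (auto simp: eigenvalue_def eigenvector_def)
    then have "norm (complex_of_real q * k) \<le> spectral_radius A"
      using spectral_radius_mem_max(2)[OF A n] by (auto simp: spectrum_def)
    then have "q * norm k \<le> spectral_radius A"
      using q(1) by (simp add: norm_mult)
    then have "q * norm k < q * 1"
      using q(3) by linarith
    then show ?thesis using q(1) by (simp only: mult_less_cancel_left_pos)
  qed
  then have "spectral_radius B < 1"
    using spectral_radius_mem_max(1)[OF B n] by (auto simp: spectrum_def)
  then obtain c where c: "\<And>k. norm_bound (B ^\<^sub>m k) c"
    using spectral_radius_jnf_norm_bound_less_1_upper_triangular[OF B] by blast
  have "norm_bound (A ^\<^sub>m k) (c * q ^ k)" for k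
    unfolding norm_bound_def
  proof (intro allI impI)
    fix i j assume "i < dim_row (A ^\<^sub>m k)" "j < dim_col (A ^\<^sub>m k)"
    then have ij: "i < n" "j < n" using A by (auto split: if_splits)
    then have "norm ((B ^\<^sub>m k) $$ (i, j)) \<le> c"
      using c[of k] B by (auto simp: norm_bound_def)
    moreover have "(A ^\<^sub>m k) $$ (i, j) = complex_of_real q ^ k * (B ^\<^sub>m k) $$ (i, j)"
      using ij B by (subst AB) (simp add: smult_pow_mat[OF B])
    ultimately show "norm ((A ^\<^sub>m k) $$ (i, j)) \<le> c * q ^ k"
      using q by (simp add: norm_mult norm_power mult.commute mult_right_mono)
  qed
  with q show ?thesis by blast
qed

text \<open>The matrix is taken over the complex numbers because non-real eigenvalues also govern
  the growth of a real linear map. Its entry bounds turn into a bound on vectors by summing over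
  coordinates.\<close>

lemma funpow_linear_geometric_bound:
  fixes L :: "'a::euclidean_space \<Rightarrow> 'a"
  assumes L: "linear L"
    and ev: "\<And>v c. \<exists>i\<in>Basis. v i \<noteq> 0 \<Longrightarrow>
      (\<forall>i\<in>Basis. (\<Sum>j\<in>Basis. complex_of_real (L j \<bullet> i) * v j) = c * v i) \<Longrightarrow> norm c < 1"
  shows "\<exists>C q. 0 < q \<and> q < 1 \<and> (\<forall>k x. norm ((L ^^ k) x) \<le> C * q ^ k * norm x)"
proof -
  obtain bs :: "'a list" where bs: "set bs = Basis" "distinct bs"
    using finite_distinct_list[OF finite_Basis] by blast
  define n where "n = length bs"
  have bij: "bij_betw ((!) bs) {..<n} Basis"
    using bs by (auto simp: n_def intro!: bij_betw_nth)
  have n: "n > 0"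
    using bs nonempty_Basis by (metis n_def length_greater_0_conv set_empty)
  have sum_bs: "(\<Sum>l<n. h (bs ! l)) = (\<Sum>b\<in>Basis. h b)" for h :: "'a \<Rightarrow> 'b::comm_monoid_add"
    by (rule sum.reindex_bij_betw[OF bij])
  define A where "A = mat n n (\<lambda>(i, j). complex_of_real (L (bs ! j) \<bullet> bs ! i))"
  have A: "A \<in> carrier_mat n n" by (simp add: A_def)
  have "norm c < 1" if c: "eigenvalue A c" for c
  proof -
    obtain v where v: "v \<in> carrier_vec n" "v \<noteq> 0\<^sub>v n" "A *\<^sub>v v = c \<cdot>\<^sub>v v"
      using c A by (auto simp: eigenvalue_def eigenvector_def)
    define w where "w b = vec_index v (inv_into {..<n} ((!) bs) b)" for b
    have w: "w (bs ! l) = vec_index v l" if "l < n" for l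
      using that bij_betw_inv_into_left[OF bij] by (simp add: w_def)
    show ?thesis
    proof (rule ev)
      obtain l where l: "l < n" "vec_index v l \<noteq> 0"
        using v(1,2) by (auto simp: vec_eq_iff)
      then show "\<exists>i\<in>Basis. w i \<noteq> 0"
        using w bij by (metis bij_betwE lessThan_iff)
      show "\<forall>i\<in>Basis. (\<Sum>j\<in>Basis. complex_of_real (L j \<bullet> i) * w j) = c * w i"
      proof
        fix b :: 'a assume "b \<in> Basis"
        then obtain i where i: "i < n" "b = bs ! i"
          using bij by (auto simp: bij_betw_def)
        have "(\<Sum>j\<in>Basis. complex_of_real (L j \<bullet> b) * w j)
            = (\<Sum>l<n. complex_of_real (L (bs ! l) \<bullet> b) * w (bs ! l))"
          by (rule sum_bs[symmetric])
        also have "\<dots> = vec_index (A *\<^sub>v v) i"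
          using i v(1) w by (auto simp: A_def scalar_prod_def atLeast0LessThan intro!: sum.cong)
        also have "\<dots> = c * w b"
          using i v w by simp
        finally show "(\<Sum>j\<in>Basis. complex_of_real (L j \<bullet> b) * w j) = c * w b" .
      qed
    qed
  qed
  then obtain c q where q: "0 < q" "q < 1" and c: "\<And>k. norm_bound (A ^\<^sub>m k) (c * q ^ k)"
    using pow_mat_geometric_bound[OF A n] by blast
  have lin: "linear (L ^^ k)" for k
    using L by (induction k) (auto intro: linear_compose simp: linear_id)
  \<comment> \<open>Column \<open>j\<close> of \<open>A\<close> holds the image of the basis vector
    \<open>bs ! j\<close>. The induction step expands \<open>L (bs ! j)\<close> in the basis and
    uses linearity of \<open>L ^^ k\<close>.\<close>
  have entry: "(A ^\<^sub>m k) $$ (i, j) = complex_of_real ((L ^^ k) (bs ! j) \<bullet> bs ! i)"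
    if "i < n" "j < n" for k i j
    using that
  proof (induction k arbitrary: i j)
    case 0
    then have "bs ! i \<in> Basis" "bs ! j \<in> Basis"
      using bij bij_betwE by blast+
    then show ?case
      using 0 A bs by (auto simp: inner_Basis nth_eq_iff_index_eq n_def)
  next
    case (Suc k)
    have "(A ^\<^sub>m Suc k) $$ (i, j) = (\<Sum>l<n. (A ^\<^sub>m k) $$ (i, l) * A $$ (l, j))"
      using Suc.prems A by (auto simp: scalar_prod_def atLeast0LessThan intro!: sum.cong)
    also have "\<dots> = complex_of_real (\<Sum>l<n. ((L ^^ k) (bs ! l) \<bullet> bs ! i) * (L (bs ! j) \<bullet> bs ! l))"
      using Suc by (auto simp: A_def intro!: sum.cong)
    also have "(\<Sum>l<n. ((L ^^ k) (bs ! l) \<bullet> bs ! i) * (L (bs ! j) \<bullet> bs ! l))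
        = (\<Sum>b\<in>Basis. ((L ^^ k) b \<bullet> bs ! i) * (L (bs ! j) \<bullet> b))"
      by (rule sum_bs)
    also have "\<dots> = (L ^^ k) (\<Sum>b\<in>Basis. (L (bs ! j) \<bullet> b) *\<^sub>R b) \<bullet> bs ! i"
      by (simp add: linear_sum[OF lin] linear_scale[OF lin] inner_sum_left mult.commute)
    also have "\<dots> = (L ^^ Suc k) (bs ! j) \<bullet> bs ! i"
      by (simp add: euclidean_representation funpow_swap1)
    finally show ?case .
  qed
  have abs_entry: "\<bar>(L ^^ k) b \<bullet> i\<bar> \<le> c * q ^ k" if "b \<in> Basis" "i \<in> Basis" for k b i
  proof -
    have "b \<in> (!) bs ` {..<n}" "i \<in> (!) bs ` {..<n}"
      using that bij_betw_imp_surj_on[OF bij] by simp_all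
    then obtain l m where lm: "l < n" "b = bs ! l" "m < n" "i = bs ! m"
      by auto
    moreover have "norm ((A ^\<^sub>m k) $$ (m, l)) \<le> c * q ^ k"
      using c[of k] A lm(1,3) by (simp add: norm_bound_def)
    ultimately show ?thesis
      using entry[of m l k] by simp
  qed
  \<comment> \<open>One dimension factor comes from bounding the norm of each image
    \<open>(L ^^ k) b\<close> by its coordinates, the other from expanding \<open>x\<close> in the
    basis.\<close>
  have "norm ((L ^^ k) x) \<le> (real DIM('a) * (real DIM('a) * c)) * q ^ k * norm x" for k x
  proof -
    have b: "norm ((L ^^ k) b) \<le> real DIM('a) * (c * q ^ k)" if "b \<in> Basis" for b
      using norm_le_l1[of "(L ^^ k) b"] sum_bounded_above[of Basis "\<lambda>i. \<bar>(L ^^ k) b \<bullet> i\<bar>" "c * q ^ k"]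
        abs_entry[OF that] by fastforce
    have "norm ((L ^^ k) x) = norm (\<Sum>b\<in>Basis. (x \<bullet> b) *\<^sub>R (L ^^ k) b)"
      by (subst euclidean_representation[of x, symmetric])
        (simp add: linear_sum[OF lin] linear_scale[OF lin])
    also have "\<dots> \<le> (\<Sum>b\<in>(Basis::'a set). norm x * (real DIM('a) * (c * q ^ k)))"
      using b by (intro sum_norm_le) (auto intro!: mult_mono Basis_le_norm)
    finally show ?thesis by (simp add: algebra_simps)
  qed
  with q show ?thesis by blast
qed

section \<open>Uniform convergence of iterates near a fixed point and near points of its
  basin\<close>

text \<open>The eigenvalue condition need not make the derivative a contraction in the Euclidean
  norm, but it does so for a high power. Uniformity on a ball will allow one step number to serve
  all points of the ball.\<close>

lemma uniform_limit_funpow_fixpoint: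
  fixes f :: "'a::euclidean_space \<Rightarrow> 'a"
  assumes diff: "f differentiable (at a)" and fixpt: "f a = a"
    and ev: "\<And>c. jacobian_eigenvalue f a c \<Longrightarrow> norm c < 1"
  shows "\<exists>\<rho>>0. uniform_limit (ball a \<rho>) (\<lambda>n. f ^^ n) (\<lambda>_. a) sequentially"
proof -
  define L where "L = frechet_derivative f (at a)"
  have fL: "(f has_derivative L) (at a)"
    using diff by (simp add: L_def frechet_derivative_works)
  then have "linear L"
    by (rule has_derivative_linear)
  then obtain C q where q: "0 < q" "q < 1"
    and C: "\<And>k x. norm ((L ^^ k) x) \<le> C * q ^ k * norm x"
    using funpow_linear_geometric_bound[of L] ev
    unfolding jacobian_eigenvalue_def L_def by blast
  have "(\<lambda>k. C * q ^ k) \<longlonglongrightarrow> 0"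
    using q by (intro tendsto_mult_right_zero LIMSEQ_realpow_zero) auto
  then have "eventually (\<lambda>k. C * q ^ k < 1 / 2 \<and> k > 0) sequentially"
    by (intro eventually_conj order_tendstoD eventually_gt_at_top) auto
  then obtain p where p: "C * q ^ p < 1 / 2" "p > 0"
    by (auto simp: eventually_sequentially)
  have fixn: "(f ^^ k) a = a" for k
    by (induction k) (auto simp: fixpt)
  have der: "((f ^^ k) has_derivative (L ^^ k)) (at a)" for k
  proof (induction k)
    case (Suc k)
    show ?case
      using diff_chain_at[OF Suc, of f L] fL by (simp add: fixn o_def)
  qed (simp add: id_def)
  \<comment> \<open>An error of 1/4 in the linear approximation, added to the factor 1/2 of
    \<open>L ^^ p\<close>, leaves the contraction factor 3/4.\<close>
  obtain d where d: "d > 0" and d_der: "\<And>y. norm (y - a) < d \<Longrightarrow>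
      norm ((f ^^ p) y - (f ^^ p) a - (L ^^ p) (y - a)) \<le> 1 / 4 * norm (y - a)"
    using der[of p] unfolding has_derivative_at_alt by (meson zero_less_divide_1_iff zero_less_numeral)
  have contr: "dist ((f ^^ p) y) a \<le> 3 / 4 * dist y a" if y: "dist y a < d" for y
  proof -
    have "norm ((L ^^ p) (y - a)) \<le> 1 / 2 * norm (y - a)"
      using C[of p "y - a"] mult_right_mono[of "C * q ^ p" "1 / 2" "norm (y - a)"] p by force
    moreover have "norm ((f ^^ p) y - a - (L ^^ p) (y - a)) \<le> 1 / 4 * norm (y - a)"
      using d_der[of y] y by (simp add: fixn dist_norm)
    ultimately show ?thesis
      using norm_triangle_ineq[of "(f ^^ p) y - a - (L ^^ p) (y - a)" "(L ^^ p) (y - a)"]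
      by (simp add: dist_norm)
  qed
  \<comment> \<open>The distance to \<open>a\<close> never grows, so every iterate of
    \<open>f ^^ p\<close> stays where \<open>contr\<close> applies.\<close>
  have geo: "dist (((f ^^ p) ^^ k) y) a \<le> (3 / 4) ^ k * dist y a" if y: "dist y a < d" for k y
  proof (induction k)
    case (Suc k)
    have "(3 / 4) ^ k * dist y a \<le> 1 * dist y a"
      by (intro mult_right_mono power_le_one) auto
    then have "dist (((f ^^ p) ^^ k) y) a < d"
      using Suc y by linarith
    from contr[OF this] Suc show ?case by simp
  qed simp
  have "uniform_limit (ball a d) (\<lambda>n. f ^^ n) (\<lambda>_. a) sequentially"
    unfolding uniform_limit_sequentially_iff
  proof (intro allI impI)
    fix e :: real assume e: "e > 0"
    \<comment> \<open>the at most \<open>p - 1\<close> iterations left over after applying \<open>f\<^sup>p\<close> are controlled by continuity at \<open>a\<close>\<close>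
    have "\<forall>s. \<exists>h>0. \<forall>y. dist y a < h \<longrightarrow> dist ((f ^^ s) y) a < e"
      using has_derivative_continuous[OF der] e unfolding continuous_at_eps_delta
      by (metis fixn)
    then obtain h where h: "\<And>s. h s > (0::real)"
      "\<And>s y. dist y a < h s \<Longrightarrow> dist ((f ^^ s) y) a < e" by metis
    \<comment> \<open>One radius serves all remainders modulo \<open>p\<close>; the set is nonempty
      because \<open>p > 0\<close>.\<close>
    define m where "m = Min (h ` {..<p})"
    have m: "m > 0" "\<And>s. s < p \<Longrightarrow> m \<le> h s"
      using p(2) h(1) unfolding m_def by (subst Min_gr_iff, auto)
    have "(\<lambda>k. (3 / 4) ^ k * d) \<longlonglongrightarrow> 0"
      by (intro tendsto_mult_left_zero LIMSEQ_realpow_zero) auto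
    then have "eventually (\<lambda>k. (3 / 4) ^ k * d < m) sequentially"
      using m(1) by (rule order_tendstoD(2))
    then obtain k0 where k0: "\<And>k. k \<ge> k0 \<Longrightarrow> (3 / 4) ^ k * d < m"
      by (auto simp: eventually_sequentially)
    show "\<exists>N. \<forall>n\<ge>N. \<forall>y\<in>ball a d. dist ((f ^^ n) y) a < e"
    proof (intro exI allI impI ballI)
      \<comment> \<open>The bound \<open>p * k0\<close> ensures at least \<open>k0\<close> complete
        blocks of \<open>p\<close> iterations; these are carried out first and the remainder
        afterwards.\<close>
      fix n y assume n: "n \<ge> p * k0" and "y \<in> ball a d"
      then have y: "dist y a < d" by (simp add: dist_commute)
      have k: "n div p \<ge> k0"
        using n p by (simp add: less_eq_div_iff_mult_less_eq mult.commute)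
      have "(f ^^ n) y = (f ^^ (n mod p + p * (n div p))) y"
        by simp
      also have "\<dots> = (f ^^ (n mod p)) (((f ^^ p) ^^ (n div p)) y)"
        by (simp only: funpow_add funpow_mult o_apply)
      finally have eq: "(f ^^ n) y = (f ^^ (n mod p)) (((f ^^ p) ^^ (n div p)) y)" .
      have "dist (((f ^^ p) ^^ (n div p)) y) a \<le> (3 / 4) ^ (n div p) * d"
        using geo[OF y, of "n div p"] y
        by (meson less_imp_le mult_left_mono order_trans zero_le_divide_iff zero_le_numeral zero_le_power)
      also have "\<dots> < h (n mod p)"
        using k0[OF k] m(2)[of "n mod p"] p by force
      finally show "dist ((f ^^ n) y) a < e"
        unfolding eq by (rule h(2))
    qed
  qed
  with d show ?thesis by blast
qed

text \<open>A fixed number \<open>n0\<close> of iterations brings \<open>x\<close> into the ball of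
  uniform convergence. The map \<open>f ^^ n0\<close> is continuous, so it brings a whole
  neighbourhood of \<open>x\<close> there, at the cost of delaying the bound by
  \<open>n0\<close>.\<close>

lemma uniform_limit_funpow_basin:
  fixes f :: "'a::metric_space \<Rightarrow> 'a"
  assumes cont: "continuous_on UNIV f" and x: "x \<in> basin f a"
    and \<rho>: "\<rho> > 0" and lim: "uniform_limit (ball a \<rho>) (\<lambda>n. f ^^ n) (\<lambda>_. a) sequentially"
  shows "\<exists>\<eta>>0. uniform_limit (ball x \<eta>) (\<lambda>n. f ^^ n) (\<lambda>_. a) sequentially"
proof -
  have "(\<lambda>n. (f ^^ n) x) \<longlonglongrightarrow> a"
    using x by (simp add: basin_def)
  then obtain n0 where n0: "(f ^^ n0) x \<in> ball a \<rho>"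
    using \<rho> by (metis LIMSEQ_def dist_commute mem_ball order_refl)
  have "continuous_on UNIV (f ^^ n0)"
  proof (induction n0)
    case (Suc n)
    show ?case
      using continuous_on_compose[OF Suc, of f] cont continuous_on_subset by auto
  qed (simp add: id_def)
  then have "open ((f ^^ n0) -` ball a \<rho>)"
    by (simp add: open_vimage)
  then obtain \<eta> where \<eta>: "\<eta> > 0" "\<And>y. y \<in> ball x \<eta> \<Longrightarrow> (f ^^ n0) y \<in> ball a \<rho>"
    using n0 unfolding open_contains_ball by blast
  have "uniform_limit (ball x \<eta>) (\<lambda>n. f ^^ n) (\<lambda>_. a) sequentially"
    unfolding uniform_limit_sequentially_iff
  proof (intro allI impI)
    fix e :: real assume "e > 0"
    then obtain N where N: "\<And>n y. n \<ge> N \<Longrightarrow> y \<in> ball a \<rho> \<Longrightarrow> dist ((f ^^ n) y) a < e"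
      using lim unfolding uniform_limit_sequentially_iff by blast
    show "\<exists>N. \<forall>n\<ge>N. \<forall>y\<in>ball x \<eta>. dist ((f ^^ n) y) a < e"
    proof (intro exI allI impI ballI)
      fix n y assume n: "n \<ge> N + n0" and y: "y \<in> ball x \<eta>"
      have "(f ^^ n) y = (f ^^ (n - n0 + n0)) y"
        using n by simp
      also have "\<dots> = (f ^^ (n - n0)) ((f ^^ n0) y)"
        by (simp only: funpow_add o_apply)
      finally show "dist ((f ^^ n) y) a < e"
        using N[of "n - n0" "(f ^^ n0) y"] n \<eta>(2)[OF y] by simp
    qed
  qed
  with \<eta> show ?thesis by blast
qed

section \<open>Eventually periodic orbits and powers of partial maps\<close>

text \<open>The pigeonhole principle gives a repetition. Taking \<open>K\<close> as the least gap
  between equal values anywhere along the orbit, not just from one starting index, makes any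
  \<open>K\<close> consecutive values distinct.\<close>

lemma funpow_eventually_periodic:
  assumes fin: "finite S" and g: "g \<in> S \<rightarrow> S" and x: "x \<in> S"
  shows "\<exists>K>0. \<exists>p. \<forall>i\<ge>p. (g ^^ (i + K)) x = (g ^^ i) x \<and> inj_on (\<lambda>j. (g ^^ (i + j)) x) {..<K}"
proof -
  let ?P = "\<lambda>K. K > 0 \<and> (\<exists>p. (g ^^ (p + K)) x = (g ^^ p) x)"
  have "(g ^^ i) x \<in> S" for i
    using g x by (induction i) auto
  then have "\<not> inj (\<lambda>i. (g ^^ i) x)"
    using fin by (metis (mono_tags, lifting) finite_subset image_subsetI infinite_UNIV_nat finite_imageD)
  then obtain i j where "i < j" "(g ^^ i) x = (g ^^ j) x"
    by (metis injI linorder_neqE_nat)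
  then have "?P (j - i)"
    by (auto intro!: exI[of _ i])
  define K where "K = (LEAST K. ?P K)"
  have "?P K"
    unfolding K_def by (rule LeastI) fact
  then obtain p where K: "K > 0" and p: "(g ^^ (p + K)) x = (g ^^ p) x"
    by blast
  have min: "\<not> ?P k" if "k < K" for k
    using that not_less_Least unfolding K_def by blast
  have period: "(g ^^ (i + K)) x = (g ^^ i) x" if "i \<ge> p" for i
    using that
  proof (induction i rule: dec_induct)
    case (step i)
    then show ?case by simp
  qed (rule p)
  have "inj_on (\<lambda>j. (g ^^ (i + j)) x) {..<K}" for i
  proof (rule linorder_inj_onI)
    fix j k assume jk: "j < k" "j \<in> {..<K}" "k \<in> {..<K}"
    show "(g ^^ (i + j)) x \<noteq> (g ^^ (i + k)) x"
    proof
      assume "(g ^^ (i + j)) x = (g ^^ (i + k)) x"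
      then have "(g ^^ (i + j + (k - j))) x = (g ^^ (i + j)) x"
        using jk by simp
      then have "?P (k - j)"
        using jk(1) zero_less_diff by blast
      moreover have "k - j < K"
        using jk by auto
      ultimately show False
        using min by blast
    qed
  qed auto
  with K period show ?thesis by blast
qed

text \<open>Intended for \<open>g\<close> a composition of two limit maps, which advances an
  alternating orbit by two places and whose value is known at one parity only.\<close>

lemma map_power_shift:
  assumes "\<And>i. even i \<Longrightarrow> g (s i) = Some (s (i + 2))" and "even i"
  shows "map_power g k (s i) = Some (s (i + 2 * k))"
  using assms by (induction k) (auto simp: map_comp_def)


section \<open>Shadowing of the orbit of limits, and its periodic loop\<close>

theorem theorem8:
  fixes F :: "nat \<Rightarrow> 'a::euclidean_space \<Rightarrow> 'a"
    and S :: "nat \<Rightarrow> 'a set"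
    and \<alpha> :: "nat \<Rightarrow> nat"
    and im :: 'a
  assumes alpha: "\<alpha> 1 = 2" "\<alpha> 2 = 1"
    and diff: "\<forall>r\<in>{1, 2}. \<forall>x. F r differentiable (at x)"
    and fixed: "\<forall>r\<in>{1, 2}. S r \<subseteq> {x. F r x = x}"
    and a: "\<forall>r\<in>{1, 2}. \<forall>a\<in>S r. \<forall>c. jacobian_eigenvalue (F r) a c \<longrightarrow> norm c < 1"
    and b: "finite (S 1)" "finite (S 2)" "S 1 \<inter> S 2 = {}"
    and c: "\<exists>a\<in>S 1. im \<in> basin (F 1) a"
    and d: "\<forall>r\<in>{1, 2}. \<forall>a\<in>S r. \<exists>a'\<in>S (\<alpha> r). \<exists>\<delta>>0.
              a \<in> basin (F (\<alpha> r)) a' \<and> ball a \<delta> \<subseteq> basin (F (\<alpha> r)) a'"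
  shows "\<exists>K b. K > 0 \<and> even K \<and>
    bipartite_convergent_second (alt_seq (F 1) (F 2) im) K b \<and>
    (\<forall>h<K. (even h \<longrightarrow> attractor (F 1) (b h)) \<and> (odd h \<longrightarrow> attractor (F 2) (b h))) \<and>
    (\<forall>h<K. (even h \<longrightarrow> limit_map (F 2) (b h) = Some (b (Suc h mod K))) \<and>
           (odd h \<longrightarrow> limit_map (F 1) (b h) = Some (b (Suc h mod K)))) \<and>
    (\<forall>h<K. (even h \<longrightarrow>
              map_power (limit_map (F 1) \<circ>\<^sub>m limit_map (F 2)) (K div 2) (b h) = Some (b h)) \<and>
           (odd h \<longrightarrow>
              map_power (limit_map (F 2) \<circ>\<^sub>m limit_map (F 1)) (K div 2) (b h) = Some (b h)))"
proof -
  have stable: "\<exists>\<rho>>0. uniform_limit (ball x \<rho>) (\<lambda>n. F r ^^ n) (\<lambda>_. x) sequentially"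
    if "r \<in> {1, 2}" "x \<in> S r" for r x
    using that diff fixed a by (intro uniform_limit_funpow_fixpoint) auto
  have attr: "attractor (F r) x" if r: "r \<in> {1, 2}" and x: "x \<in> S r" for r x
  proof -
    obtain \<rho> where "\<rho> > 0" "uniform_limit (ball x \<rho>) (\<lambda>n. F r ^^ n) (\<lambda>_. x) sequentially"
      using stable[OF r x] by blast
    then show ?thesis
      using r x fixed unfolding attractor_def
      by (auto intro!: exI[of _ "ball x \<rho>"] dest: tendsto_uniform_limitI)
  qed
  have cont: "continuous_on UNIV (F r)" if "r \<in> {1, 2}" for r
    using diff that differentiable_imp_continuous_within by (auto simp: continuous_on_eq_continuous_within)
  \<comment> \<open>The map to be applied next is read off from the point itself, consistently
    because the two sets are disjoint. The passage to the next limit thus becomes a single self-map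
    \<open>nxt\<close> of the union.\<close>
  define R where "R x = (if x \<in> S 1 then 2 else 1 :: nat)" for x
  have R: "R x \<in> {1, 2}" for x
    by (simp add: R_def)
  have "\<forall>x\<in>S 1 \<union> S 2. \<exists>y\<in>S (R x). x \<in> basin (F (R x)) y"
    using d b(3) alpha unfolding R_def by fastforce
  then obtain nxt where nxt: "\<And>x. x \<in> S 1 \<union> S 2 \<Longrightarrow> nxt x \<in> S (R x)"
    "\<And>x. x \<in> S 1 \<union> S 2 \<Longrightarrow> x \<in> basin (F (R x)) (nxt x)"
    by metis
  have "\<exists>\<eta>>0. uniform_limit (ball x \<eta>) (\<lambda>n. F (R x) ^^ n) (\<lambda>_. nxt x) sequentially"
    if "x \<in> S 1 \<union> S 2" for x
    using uniform_limit_funpow_basin[OF cont[OF R] nxt(2)[OF that]] stable[OF R nxt(1)[OF that]]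
    by blast
  then obtain \<eta> where \<eta>: "\<And>x. x \<in> S 1 \<union> S 2 \<Longrightarrow> \<eta> x > 0"
    "\<And>x. x \<in> S 1 \<union> S 2 \<Longrightarrow>
      uniform_limit (ball x (\<eta> x)) (\<lambda>n. F (R x) ^^ n) (\<lambda>_. nxt x) sequentially"
    by metis
  obtain a0 where a0: "a0 \<in> S 1" "im \<in> basin (F 1) a0"
    using c by blast
  \<comment> \<open>The ideal orbit: \<open>s i\<close> is the expected position of the element of
    \<open>alt_seq\<close> at index \<open>Suc i\<close>, since index 0 is
    \<open>im\<close>.\<close>
  define s where "s i = (nxt ^^ i) a0" for i
  have s_S: "s i \<in> S (if even i then 1 else 2)" for i
  proof (induction i)
    case (Suc i)
    then show ?case
      using nxt(1)[of "s i"] b(3) by (auto simp: s_def R_def split: if_splits)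
  qed (use a0 in \<open>simp add: s_def\<close>)
  have s_mem: "s i \<in> S 1 \<union> S 2" for i
    using s_S[of i] by (auto split: if_splits)
  have s_R: "R (s i) = (if even i then 2 else 1)" for i
    using s_S[of i] b(3) by (auto simp: R_def split: if_splits)
  have s_Suc: "nxt (s i) = s (Suc i)" for i
    by (simp add: s_def)
  \<comment> \<open>Values at even and odd places lie in disjoint sets. This will force the period
    to be even.\<close>
  have s_parity: "even i \<longleftrightarrow> even j" if "s i = s j" for i j
    using that s_S[of i] s_S[of j] b(3) by (auto split: if_splits)

  \<comment> \<open>\<open>N\<close> does not depend on \<open>i\<close>: errors do not accumulate,
    since each stage restores the same tolerance.\<close>
  have T_near: "\<exists>N\<ge>1. \<forall>n1\<ge>N. \<forall>n2\<ge>N. \<forall>i. dist (alt_seq (F 1) (F 2) im n1 n2 (Suc i)) (s i) < \<epsilon>"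
    if "\<epsilon> > 0" for \<epsilon>
  proof -
    \<comment> \<open>A minimum over a finite set, hence positive. Being within \<open>e\<close> of
      \<open>s i\<close> places an element in the ball of uniform convergence around
      \<open>s i\<close>, and the next stage ends within \<open>e\<close> of
      \<open>s (Suc i)\<close>.\<close>
    define e where "e = Min (insert \<epsilon> (\<eta> ` (S 1 \<union> S 2)))"
    have e: "e > 0" "e \<le> \<epsilon>" "\<And>x. x \<in> S 1 \<union> S 2 \<Longrightarrow> e \<le> \<eta> x"
      using that b \<eta>(1) by (auto simp: e_def)
    have "eventually (\<lambda>n. \<forall>y\<in>ball x (\<eta> x). dist ((F (R x) ^^ n) y) (nxt x) < e) sequentially"
      if "x \<in> S 1 \<union> S 2" for x
      using \<eta>(2)[OF that] e(1) by (auto simp: uniform_limit_iff)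
    then have "eventually (\<lambda>n. \<forall>x\<in>S 1 \<union> S 2. \<forall>y\<in>ball x (\<eta> x).
        dist ((F (R x) ^^ n) y) (nxt x) < e) sequentially"
      using b by (intro eventually_ball_finite) auto
    moreover have "eventually (\<lambda>n. dist ((F 1 ^^ n) im) a0 < e) sequentially"
      using a0(2) e(1) by (auto simp: basin_def dest: tendstoD)
    ultimately have "eventually (\<lambda>n. (\<forall>x\<in>S 1 \<union> S 2. \<forall>y\<in>ball x (\<eta> x).
        dist ((F (R x) ^^ n) y) (nxt x) < e) \<and> dist ((F 1 ^^ n) im) a0 < e) sequentially"
      by (rule eventually_conj)
    then obtain N where N: "\<And>n x y. n \<ge> N \<Longrightarrow> x \<in> S 1 \<union> S 2 \<Longrightarrow> y \<in> ball x (\<eta> x) \<Longrightarrow>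
        dist ((F (R x) ^^ n) y) (nxt x) < e" "\<And>n. n \<ge> N \<Longrightarrow> dist ((F 1 ^^ n) im) a0 < e"
      unfolding eventually_sequentially by metis
    have "dist (alt_seq (F 1) (F 2) im n1 n2 (Suc i)) (s i) < e" if n: "n1 \<ge> N" "n2 \<ge> N" for n1 n2 i
    proof (induction i)
      case 0
      show ?case using N(2)[OF n(1)] by (simp add: s_def)
    next
      case (Suc i)
      have "alt_seq (F 1) (F 2) im n1 n2 (Suc i) \<in> ball (s i) (\<eta> (s i))"
        using Suc e(3)[OF s_mem[of i]] by (simp only: mem_ball dist_commute)
      \<comment> \<open>The parity of \<open>i\<close> selects the step number, in agreement with
        \<open>R (s i)\<close>.\<close>
      from N(1)[OF n(1) s_mem this] N(1)[OF n(2) s_mem this] show ?case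
        by (cases "even i") (simp_all add: s_R s_Suc)
    qed
    then show ?thesis
      using e(2) by (intro exI[of _ "max N 1"]) (auto intro: less_le_trans simp del: alt_seq.simps)
  qed

  have "nxt \<in> S 1 \<union> S 2 \<rightarrow> S 1 \<union> S 2"
  proof (rule Pi_I)
    fix x assume "x \<in> S 1 \<union> S 2"
    then show "nxt x \<in> S 1 \<union> S 2"
      using nxt(1)[of x] R[of x] by auto
  qed
  then obtain K p where K: "K > 0" and period: "\<And>i. i \<ge> p \<Longrightarrow> s (i + K) = s i"
    and inj: "\<And>i. i \<ge> p \<Longrightarrow> inj_on (\<lambda>j. s (i + j)) {..<K}"
    using funpow_eventually_periodic[of "S 1 \<union> S 2" nxt a0] a0(1) b unfolding s_def by blast
  have evK: "even K"
    using s_parity[OF period[OF order_refl]] even_add by blast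
  \<comment> \<open>the offset must lie beyond the pre-period and be divisible by \<open>K\<close>, so that \<open>t\<close> and \<open>s\<close> are in phase\<close>
  define M where "M = p * K"
  \<comment> \<open>Evenness of \<open>M\<close> preserves parity, so even places of
    \<open>t\<close> lie in \<open>S 1\<close> and odd ones in \<open>S 2\<close>.\<close>
  have M: "even M" "M \<ge> p"
    using evK K by (auto simp: M_def)
  define t where "t = (\<lambda>j. s (M + j))"
  have t_K: "t (j + K) = t j" for j
    using period[of "M + j"] M by (simp add: t_def add.assoc)
  have t_mult: "t (j + m * K) = t j" for j m
  proof (induction m)
    case (Suc m)
    then show ?case
      using t_K[of "j + m * K"] by (simp add: algebra_simps)
  qed simp
  have t_mod: "t (j mod K) = t j" for j
    using t_mult[of "j mod K" "j div K"] by simp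
  have t_S: "t j \<in> S (if even j then 1 else 2)" for j
    using s_S[of "M + j"] M by (simp add: t_def)
  have lim_step: "limit_map (F (if even j then 2 else 1)) (t j) = Some (t (Suc j))" for j
  proof -
    have "(\<lambda>n. (F (if even j then 2 else 1) ^^ n) (t j)) \<longlonglongrightarrow> t (Suc j)"
      using nxt(2)[OF s_mem[of "M + j"]] s_R[of "M + j"] M
      by (simp add: t_def basin_def s_Suc)
    then show ?thesis
      by (auto simp: limit_map_def convergent_def limI)
  qed
  have even_step: "limit_map (F 2) (t j) = Some (t (Suc j))" if "even j" for j
    using lim_step[of j] that by simp
  have odd_step: "limit_map (F 1) (t j) = Some (t (Suc j))" if "odd j" for j
    using lim_step[of j] that by simp
  have "bipartite_convergent_second (alt_seq (F 1) (F 2) im) K t"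
    unfolding bipartite_convergent_second_def
  proof (intro conjI allI impI)
    show "inj_on t {..<K}"
      using inj[OF M(2)] by (simp add: t_def)
    fix j and \<epsilon> :: real assume "\<epsilon> > 0"
    from T_near[OF this] obtain N where N: "N \<ge> 1" "\<And>n1 n2 i. n1 \<ge> N \<Longrightarrow> n2 \<ge> N \<Longrightarrow>
        dist (alt_seq (F 1) (F 2) im n1 n2 (Suc i)) (s i) < \<epsilon>"
      by blast
    \<comment> \<open>For \<open>m \<ge> p\<close> the place \<open>m * K + j\<close> lies
      \<open>m - p\<close> full periods beyond \<open>M + j\<close>. Hence the common bound
      \<open>max N p\<close> below.\<close>
    have s_t: "s (m * K + j) = t j" if m: "m \<ge> p" for m
    proof -
      obtain l where "m = p + l"
        using le_Suc_ex[OF m] by blast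
      then have "m * K + j = M + (j + (m - p) * K)"
        by (simp add: M_def algebra_simps)
      then show ?thesis
        using t_mult[of j "m - p"] unfolding t_def by (simp only:)
    qed
    show "\<exists>N\<ge>1. \<forall>m\<ge>N. \<forall>n1\<ge>N. \<forall>n2\<ge>N.
        dist (alt_seq (F 1) (F 2) im n1 n2 (1 + m * K + j)) (t j) < \<epsilon>"
    proof (intro exI[of _ "max N p"] conjI allI impI)
      fix m n1 n2 assume "m \<ge> max N p" "n1 \<ge> max N p" "n2 \<ge> max N p"
      then show "dist (alt_seq (F 1) (F 2) im n1 n2 (1 + m * K + j)) (t j) < \<epsilon>"
        using N(2)[of n1 n2 "m * K + j"] s_t[of m] by (simp del: alt_seq.simps)
    qed (use N(1) in simp)
  qed (rule K)
  moreover have "(even h \<longrightarrow> attractor (F 1) (t h)) \<and> (odd h \<longrightarrow> attractor (F 2) (t h))" for h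
    using attr[of 1 "t h"] attr[of 2 "t h"] t_S[of h] by (cases "even h") simp_all
  moreover have "(even h \<longrightarrow> limit_map (F 2) (t h) = Some (t (Suc h mod K))) \<and>
      (odd h \<longrightarrow> limit_map (F 1) (t h) = Some (t (Suc h mod K)))" for h
    using even_step[of h] odd_step[of h] t_mod[of "Suc h"] by simp
  moreover have "(even h \<longrightarrow>
        map_power (limit_map (F 1) \<circ>\<^sub>m limit_map (F 2)) (K div 2) (t h) = Some (t h)) \<and>
      (odd h \<longrightarrow>
        map_power (limit_map (F 2) \<circ>\<^sub>m limit_map (F 1)) (K div 2) (t h) = Some (t h))" for h
  proof (intro conjI impI)
    \<comment> \<open>Since \<open>K\<close> is even, \<open>K div 2\<close> double steps advance
      \<open>t\<close> by exactly one period.\<close>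
    have two: "2 * (K div 2) = K"
      using evK by simp
    have "(limit_map (F 1) \<circ>\<^sub>m limit_map (F 2)) (t i) = Some (t (i + 2))" if "even i" for i
      using even_step[OF that] odd_step[of "Suc i"] that by (simp add: map_comp_def)
    then show "map_power (limit_map (F 1) \<circ>\<^sub>m limit_map (F 2)) (K div 2) (t h) = Some (t h)"
      if "even h"
      using map_power_shift[of "limit_map (F 1) \<circ>\<^sub>m limit_map (F 2)" t h "K div 2"] that
      unfolding two t_K by blast
    \<comment> \<open>For odd places the argument is applied to the sequence shifted by one, whose
      even places are the odd places of \<open>t\<close>.\<close>
    have "(limit_map (F 2) \<circ>\<^sub>m limit_map (F 1)) (t (Suc i)) = Some (t (Suc (i + 2)))"
      if "even i" for i
      using odd_step[of "Suc i"] even_step[of "Suc (Suc i)"] that by (simp add: map_comp_def)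
    moreover assume "odd h"
    then obtain i where "even i" "h = Suc i"
      by (metis even_Suc not0_implies_Suc even_zero)
    ultimately show "map_power (limit_map (F 2) \<circ>\<^sub>m limit_map (F 1)) (K div 2) (t h) = Some (t h)"
      using map_power_shift[of "limit_map (F 2) \<circ>\<^sub>m limit_map (F 1)" "\<lambda>i. t (Suc i)" i "K div 2"]
        t_K[of h] two by simp
  qed
  ultimately show ?thesis
    using K evK by blast
qed

end
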